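(* Let $p$ be a prime and let $S\subseteq\mathbb{Z}_{p^2}$ be a generating set of the additive group $\mathbb{Z}_{p^2}$ with $S=-S$ and $0\notin S$. If $|S|<\frac{p-1}{2}$, then $O\chi(\Gamma(\mathbb{Z}_{p^2},S))=p$.
   Context: For an additive group $G$ and a subset $S\subseteq G$ closed under negation with $0\notin S$, the Cayley graph $\Gamma(G,S)$ has vertex set $G$, with $u$ and $v$ adjacent if and only if $u-v\in S$. All colourings are proper vertex colourings. Two colourings of a graph are orthogonal if whenever two distinct vertices receive the same colour in one colouring, they receive distinct colours in the other. An orthogonal colouring is a pair of orthogonal proper colourings; $O\chi(G)$ is the minimum number of colours needed for an orthogonal colouring of $G$ (both colourings drawing from the same set of that many colours). *)

theory Defs
  imports
    "HOL-Algebra.Elementary_Groups"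
    "HOL-Computational_Algebra.Primes"
    "Graph_Theory.Pair_Digraph"
begin

(* HOL-Algebra groups are written multiplicatively: u \<otimes> inv v is the difference u - v of
   the additive notation.  An undirected graph is represented by its symmetric adjacency relation;
   see pair_graph_cayley_graph below. *)
definition cayley_graph :: "('a, 'm) monoid_scheme \<Rightarrow> 'a set \<Rightarrow> 'a pair_pre_digraph" where
  "cayley_graph G S =
     \<lparr>pverts = carrier G,
      parcs = {(u, v). u \<in> carrier G \<and> v \<in> carrier G \<and> u \<otimes>\<^bsub>G\<^esub> inv\<^bsub>G\<^esub> v \<in> S}\<rparr>"

lemma pair_graph_cayley_graph:
  assumes "group G" "finite (carrier G)" "S \<subseteq> carrier G" "S = set_inv\<^bsub>G\<^esub> S" "\<one>\<^bsub>G\<^esub> \<notin> S"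
  shows "pair_graph (cayley_graph G S)"
proof -
  interpret group G by fact
  have sym: "v \<otimes>\<^bsub>G\<^esub> inv\<^bsub>G\<^esub> u \<in> S"
    if "u \<in> carrier G" "v \<in> carrier G" "u \<otimes>\<^bsub>G\<^esub> inv\<^bsub>G\<^esub> v \<in> S" for u v
  proof -
    have "inv\<^bsub>G\<^esub> (u \<otimes>\<^bsub>G\<^esub> inv\<^bsub>G\<^esub> v) \<in> set_inv\<^bsub>G\<^esub> S"
      using that(3) by (auto simp: SET_INV_def)
    then show ?thesis
      using that(1,2) assms(4) by (simp add: inv_mult_group)
  qed
  have "finite (parcs (cayley_graph G S))"
    by (rule finite_subset[of _ "carrier G \<times> carrier G"])
      (auto simp: cayley_graph_def assms(2))
  then show ?thesis
    using assms(2,5) sym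
    by unfold_locales (auto simp: cayley_graph_def symmetric_def intro!: symI)
qed

definition proper_colouring :: "'a pair_pre_digraph \<Rightarrow> 'c set \<Rightarrow> ('a \<Rightarrow> 'c) \<Rightarrow> bool" where
  "proper_colouring G C f \<longleftrightarrow>
     f \<in> pverts G \<rightarrow> C \<and> (\<forall>(u, v) \<in> parcs G. f u \<noteq> f v)"

definition orthogonal :: "'a pair_pre_digraph \<Rightarrow> ('a \<Rightarrow> 'c) \<Rightarrow> ('a \<Rightarrow> 'd) \<Rightarrow> bool" where
  "orthogonal G f g \<longleftrightarrow>
     (\<forall>u \<in> pverts G. \<forall>v \<in> pverts G. u \<noteq> v \<longrightarrow>
        (f u = f v \<longrightarrow> g u \<noteq> g v) \<and> (g u = g v \<longrightarrow> f u \<noteq> f v))"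

definition orthogonal_colouring ::
    "'a pair_pre_digraph \<Rightarrow> 'c set \<Rightarrow> ('a \<Rightarrow> 'c) \<times> ('a \<Rightarrow> 'c) \<Rightarrow> bool" where
  "orthogonal_colouring G C = (\<lambda>(f, g).
     proper_colouring G C f \<and> proper_colouring G C g \<and> orthogonal G f g)"

(* Meaningful for finite loopless graphs, where the minimum is attained (next lemma);
   otherwise the set of admissible k may be empty. *)
definition orthogonal_chromatic_number :: "'a pair_pre_digraph \<Rightarrow> nat" where
  "orthogonal_chromatic_number G =
     (LEAST k. \<exists>fg. orthogonal_colouring G {..<k} fg)"

lemma orthogonal_chromatic_number_attained:
  assumes "pair_digraph G"
  shows "\<exists>fg. orthogonal_colouring G {..<orthogonal_chromatic_number G} fg"
proof -
  interpret pair_digraph G by fact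
  obtain f where f: "bij_betw f (pverts G) {..<card (pverts G)}"
    using ex_bij_betw_finite_nat[OF pair_finite_verts] by (auto simp: atLeast0LessThan)
  have "f u \<noteq> f v" if "(u, v) \<in> parcs G" for u v
    using bij_betw_imp_inj_on[OF f] pair_no_loops[OF that] that
    by (auto simp: inj_on_def dest: in_arcsD1 in_arcsD2)
  moreover have "orthogonal G f f"
    using bij_betw_imp_inj_on[OF f] by (auto simp: orthogonal_def inj_on_def)
  ultimately have "orthogonal_colouring G {..<card (pverts G)} (f, f)"
    using bij_betwE[OF f] by (auto simp: orthogonal_colouring_def proper_colouring_def)
  then show ?thesis
    unfolding orthogonal_chromatic_number_def by (intro LeastI) (rule exI)
qed

end

theory Submission
  imports Defs
begin

text \<open>
  Write \<open>x = a + p b\<close> with base-\<open>p\<close> digits \<open>a\<close>, \<open>b\<close>, and colour \<open>x\<close> by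
  \<open>b - t a\<close> modulo \<open>p\<close>.  Colourings with different \<open>t\<close> are orthogonal, since the two
  colours determine \<open>(a, b)\<close>.  Two distinct vertices of the same colour differ by
  \<open>e (1 + p t)\<close> modulo \<open>p\<^sup>2\<close> with \<open>0 < \<bar>e\<bar> < p\<close>.  For given \<open>s\<close> at most two such \<open>e\<close>
  are congruent to \<open>s\<close> modulo \<open>p\<close>, and each determines \<open>t\<close>; so \<open>S\<close> excludes at
  most \<open>2 |S| < p - 1\<close> values of \<open>t\<close>, and two values remain.
\<close>

text \<open>Orthogonality makes a vertex recoverable from its pair of colours. This supplies the
  lower bound on the number of colours.\<close>

lemma card_pverts_le_of_orthogonal_colouring:
  assumes "orthogonal_colouring G C (f, g)" "finite C"
  shows "card (pverts G) \<le> (card C)\<^sup>2"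
proof -
  have "inj_on (\<lambda>v. (f v, g v)) (pverts G)"
    using assms(1) by (fastforce simp: orthogonal_colouring_def orthogonal_def inj_on_def)
  moreover have "(\<lambda>v. (f v, g v)) ` pverts G \<subseteq> C \<times> C"
    using assms(1) by (auto simp: orthogonal_colouring_def proper_colouring_def)
  ultimately have "card (pverts G) \<le> card (C \<times> C)"
    using assms(2) by (intro card_inj_on_le) auto
  then show ?thesis
    by (simp add: card_cartesian_product power2_eq_square)
qed

text \<open>In the plane of digit pairs (a, b) modulo \<open>p\<close>, the colour classes are the
  parallel lines of slope \<open>t\<close>, and the colour is the intercept.\<close>

definition slope_colour :: "nat \<Rightarrow> int \<Rightarrow> int \<Rightarrow> nat" where
  "slope_colour p t x = nat ((x div int p - t * (x mod int p)) mod int p)"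

lemma slope_colour_less: "0 < p \<Longrightarrow> slope_colour p t x < p"
  by (simp add: slope_colour_def nat_less_iff)

lemma slope_colour_eq_iff:
  assumes "0 < p"
  shows "slope_colour p t u = slope_colour p t v \<longleftrightarrow>
    int p dvd (u div int p - v div int p) - t * (u mod int p - v mod int p)"
proof -
  have "slope_colour p t u = slope_colour p t v \<longleftrightarrow>
      (u div int p - t * (u mod int p)) mod int p = (v div int p - t * (v mod int p)) mod int p"
    using assms by (simp add: slope_colour_def nat_eq_iff)
  then show ?thesis
    by (simp add: mod_eq_dvd_iff algebra_simps)
qed

lemma eq_if_dvd_diff_of_bounded:
  fixes a b n :: int
  assumes "n dvd a - b" "0 \<le> a" "a < n" "0 \<le> b" "b < n"
  shows "a = b"
  using assms by (metis mod_eq_dvd_iff mod_pos_pos_trivial)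

lemma div_in_range:
  fixes u :: int
  assumes "u \<in> {0..<(int p)\<^sup>2}" "0 < p"
  shows "0 \<le> u div int p" "u div int p < int p"
proof -
  show "0 \<le> u div int p"
    using assms by (simp add: pos_imp_zdiv_nonneg_iff)
  have "int p * (u div int p) \<le> u"
    by (metis assms(2) minus_mod_eq_mult_div pos_mod_sign diff_le_eq le_add_same_cancel1 of_nat_0_less_iff)
  also have "u < int p * int p"
    using assms(1) by (simp add: power2_eq_square)
  finally show "u div int p < int p"
    using assms(2) by simp
qed

lemma eq_of_mod_eq_div_eq:
  fixes u v :: int
  assumes "u div n = v div n" "u mod n = v mod n"
  shows "u = v"
  by (metis assms div_mult_mod_eq)

text \<open>Two lines of different slopes meet in at most one point: subtracting the congruences
  leaves (s - t) times the low-digit difference, and \<open>p\<close> is prime, so the low digits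
  agree and then the high ones do.\<close>

lemma slope_colour_pair_inj:
  assumes p: "prime p" and u: "u \<in> {0..<(int p)\<^sup>2}" and v: "v \<in> {0..<(int p)\<^sup>2}"
    and st: "s \<in> {0..<int p}" "t \<in> {0..<int p}" "s \<noteq> t"
    and eqs: "slope_colour p s u = slope_colour p s v" "slope_colour p t u = slope_colour p t v"
  shows "u = v"
proof -
  have p0: "0 < p" using p by (rule prime_gt_0_nat)
  let ?a = "u mod int p - v mod int p" and ?b = "u div int p - v div int p"
  have dvd: "int p dvd ?b - s * ?a" "int p dvd ?b - t * ?a"
    using eqs by (simp_all add: slope_colour_eq_iff[OF p0])
  have "int p dvd (?b - t * ?a) - (?b - s * ?a)"
    by (rule dvd_diff[OF dvd(2) dvd(1)])
  then have "int p dvd (s - t) * ?a"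
    by (simp add: algebra_simps)
  moreover have "\<not> int p dvd s - t"
    using eq_if_dvd_diff_of_bounded st by fastforce
  ultimately have "int p dvd ?a"
    using p by (simp add: prime_dvd_mult_iff)
  then have a: "u mod int p = v mod int p"
    using p0 by (intro eq_if_dvd_diff_of_bounded) auto
  then have "int p dvd ?b"
    using dvd(1) by simp
  then have "u div int p = v div int p"
    using div_in_range[OF u p0] div_in_range[OF v p0] by (intro eq_if_dvd_diff_of_bounded) auto
  then show ?thesis
    using a by (rule eq_of_mod_eq_div_eq)
qed

text \<open>The witness is the signed difference e of the low digits. Equal colours make the high
  digits differ by t e modulo \<open>p\<close>, hence u - v is e + p t e modulo p^2. If e were 0,
  both digits would agree.\<close>

lemma slope_colour_eq_imp_difference:
  assumes p0: "0 < p" and u: "u \<in> {0..<(int p)\<^sup>2}" and v: "v \<in> {0..<(int p)\<^sup>2}"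
    and "u \<noteq> v" and eq: "slope_colour p t u = slope_colour p t v"
  obtains e where "0 < \<bar>e\<bar>" "\<bar>e\<bar> < int p" "(int p)\<^sup>2 dvd (u - v) - e * (1 + int p * t)"
proof -
  let ?a = "u mod int p - v mod int p" and ?b = "u div int p - v div int p"
  have dvd: "int p dvd ?b - t * ?a"
    using eq by (simp add: slope_colour_eq_iff[OF p0])
  have "?a \<noteq> 0"
  proof
    assume a: "?a = 0"
    then have "int p dvd ?b" using dvd by simp
    then have "u div int p = v div int p"
      using div_in_range[OF u p0] div_in_range[OF v p0] by (intro eq_if_dvd_diff_of_bounded) auto
    then have "u = v"
      by (rule eq_of_mod_eq_div_eq) (use a in simp)
    with \<open>u \<noteq> v\<close> show False ..
  qed
  moreover have "\<bar>?a\<bar> < int p"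
  proof -
    have "0 \<le> u mod int p" "u mod int p < int p" "0 \<le> v mod int p" "v mod int p < int p"
      using p0 by simp_all
    then show ?thesis by linarith
  qed
  moreover have "(int p)\<^sup>2 dvd (u - v) - ?a * (1 + int p * t)"
  proof -
    have "u = int p * (u div int p) + u mod int p" "v = int p * (v div int p) + v mod int p"
      by simp_all
    then have "u - v = int p * ?b + ?a"
      by (smt (verit) right_diff_distrib)
    then have "(u - v) - ?a * (1 + int p * t) = int p * (?b - t * ?a)"
      by (simp add: algebra_simps)
    then show ?thesis
      using dvd by (simp only: power2_eq_square) (rule mult_dvd_mono[OF dvd_refl])
  qed
  ultimately show thesis
    by (intro that[of ?a]) auto
qed

text \<open>These are the slopes for which an element of \<open>S\<close> has the form that
  differences within a colour class take; every other slope gives a proper colouring.\<close>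

definition excluded_slopes :: "nat \<Rightarrow> int set \<Rightarrow> int set" where
  "excluded_slopes p S = {t \<in> {0..<int p}. \<exists>s\<in>S. \<exists>e. 0 < \<bar>e\<bar> \<and> \<bar>e\<bar> < int p \<and>
     (int p)\<^sup>2 dvd s - e * (1 + int p * t)}"

lemma card_excluded_slopes_le:
  assumes p: "prime p" and S: "finite S"
  shows "card (excluded_slopes p S) \<le> 2 * card S"
proof -
  \<comment> \<open>Each excluded slope is charged to an element of \<open>S\<close> together with
    the sign of e; the sign accounts for the factor 2.\<close>
  define r where "r = (\<lambda>t (s, pos). \<exists>e. 0 < \<bar>e\<bar> \<and> \<bar>e\<bar> < int p \<and> pos = (0 < e) \<and>
    (int p)\<^sup>2 dvd s - e * (1 + int p * t))"
  have "card (excluded_slopes p S) \<le> card (S \<times> (UNIV :: bool set))"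
  proof (rule card_le_if_inj_on_rel[where r = r])
    show "finite (S \<times> (UNIV :: bool set))" using S by simp
    show "\<exists>b. b \<in> S \<times> UNIV \<and> r t b" if "t \<in> excluded_slopes p S" for t
      using that unfolding excluded_slopes_def r_def by fastforce
    show "t = t'" if t: "t \<in> excluded_slopes p S" "t' \<in> excluded_slopes p S"
      and b: "r t b" "r t' b" for t t' b
    proof -
      obtain s pos where sp: "b = (s, pos)" by (cases b)
      obtain e where e: "0 < \<bar>e\<bar>" "\<bar>e\<bar> < int p" "pos = (0 < e)"
        "(int p)\<^sup>2 dvd s - e * (1 + int p * t)"
        using b(1) unfolding sp r_def by auto
      obtain e' where e': "0 < \<bar>e'\<bar>" "\<bar>e'\<bar> < int p" "pos = (0 < e')"
        "(int p)\<^sup>2 dvd s - e' * (1 + int p * t')"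
        using b(2) unfolding sp r_def by auto
      have d: "(int p)\<^sup>2 dvd e' * (1 + int p * t') - e * (1 + int p * t)"
        using dvd_diff[OF e(4) e'(4)] by simp
      have "int p dvd e' * (1 + int p * t') - e * (1 + int p * t)"
        using d by (rule dvd_trans[rotated]) (simp add: power2_eq_square)
      also have "e' * (1 + int p * t') - e * (1 + int p * t) =
          (e' - e) + int p * (e' * t' - e * t)"
        by (simp add: algebra_simps)
      finally have "int p dvd e' - e"
        by (simp only: dvd_add_left_iff[OF dvd_triv_left])
      \<comment> \<open>Equal signs matter here: e and e' both lie strictly between 0 and
        \<open>p\<close>, or both strictly between \<open>-p\<close> and 0.\<close>
      moreover have "\<bar>e' - e\<bar> < int p"
        using e(1-3) e'(1-3) by linarith
      ultimately have ee: "e' = e"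
        using dvd_imp_le_int[of "e' - e" "int p"] by fastforce
      \<comment> \<open>With e common to both, only the multiples of \<open>p\<close> differ; one
        factor \<open>p\<close> cancels and e is invertible modulo \<open>p\<close>, which fixes
        t.\<close>
      have "int p * int p dvd int p * (e * (t' - t))"
        using d unfolding ee by (simp add: power2_eq_square algebra_simps)
      then have "int p dvd e * (t' - t)"
        using prime_gt_0_nat[OF p] by simp
      moreover have "\<not> int p dvd e"
        using e(1,2) dvd_imp_le_int[of e "int p"] by fastforce
      ultimately have "int p dvd t' - t"
        using p by (simp add: prime_dvd_mult_iff)
      then show ?thesis
        using t eq_if_dvd_diff_of_bounded[of "int p" t' t] by (auto simp: excluded_slopes_def)
    qed
  qed
  then show ?thesis by (simp add: card_cartesian_product mult.commute)
qed

lemma slope_colour_proper: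
  assumes p: "prime p" and "0 \<notin> S" and t: "t \<in> {0..<int p} - excluded_slopes p S"
  shows "proper_colouring (cayley_graph (integer_mod_group (p\<^sup>2)) S) {..<p} (slope_colour p t)"
proof -
  have p0: "0 < p" using p by (rule prime_gt_0_nat)
  have "slope_colour p t u \<noteq> slope_colour p t v"
    if u: "u \<in> {0..<(int p)\<^sup>2}" and v: "v \<in> {0..<(int p)\<^sup>2}" and d: "(u - v) mod (int p)\<^sup>2 \<in> S"
    for u v
  proof
    assume eq: "slope_colour p t u = slope_colour p t v"
    have "u \<noteq> v" using d \<open>0 \<notin> S\<close> by auto
    then obtain e where e: "0 < \<bar>e\<bar>" "\<bar>e\<bar> < int p"
      "(int p)\<^sup>2 dvd (u - v) - e * (1 + int p * t)"
      using slope_colour_eq_imp_difference[OF p0 u v _ eq] by metis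
    \<comment> \<open>Adjacency tests the reduced difference, while divisibility sees only its class
      modulo p^2.\<close>
    have "(int p)\<^sup>2 dvd (u - v) mod (int p)\<^sup>2 - e * (1 + int p * t)"
      using e(3) by (metis mod_eq_dvd_iff mod_mod_trivial)
    then show False
      using t d e(1,2) unfolding excluded_slopes_def by blast
  qed
  moreover have "u \<otimes>\<^bsub>integer_mod_group (p\<^sup>2)\<^esub> inv\<^bsub>integer_mod_group (p\<^sup>2)\<^esub> v = (u - v) mod (int p)\<^sup>2"
    if "v \<in> carrier (integer_mod_group (p\<^sup>2))" for u v
    using that p0 by (simp add: inv_integer_mod_group mult_integer_mod_group mod_simps)
  ultimately show ?thesis
    using p0 by (auto simp: proper_colouring_def cayley_graph_def slope_colour_less
      carrier_integer_mod_group)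
qed

theorem theorem6:
  fixes p :: nat and S :: "int set"
  assumes "prime p"
    and "S \<subseteq> carrier (integer_mod_group (p\<^sup>2))"
    and "generate (integer_mod_group (p\<^sup>2)) S = carrier (integer_mod_group (p\<^sup>2))"
    and "S = set_inv\<^bsub>integer_mod_group (p\<^sup>2)\<^esub> S"
    and "\<one>\<^bsub>integer_mod_group (p\<^sup>2)\<^esub> \<notin> S"
    and "real (card S) < (real p - 1) / 2"
  shows "orthogonal_chromatic_number (cayley_graph (integer_mod_group (p\<^sup>2)) S) = p"
proof -
  let ?G = "cayley_graph (integer_mod_group (p\<^sup>2)) S"
  have p0: "0 < p" using \<open>prime p\<close> by (rule prime_gt_0_nat)
  have verts: "pverts ?G = {0..<(int p)\<^sup>2}"
    using p0 by (simp add: cayley_graph_def carrier_integer_mod_group)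
  have "finite S"
    using assms(2) p0 by (auto simp: carrier_integer_mod_group intro: finite_subset)
  have "0 \<notin> S"
    using assms(5) by simp
  let ?T = "{0..<int p} - excluded_slopes p S"
  have "card ?T = p - card (excluded_slopes p S)"
    by (subst card_Diff_subset) (auto simp: excluded_slopes_def intro: finite_subset[of _ "{0..<int p}"])
  \<comment> \<open>Integrality turns the strict real bound into a gap of 2, which leaves the two
    slopes needed.\<close>
  moreover have "2 * card S + 2 \<le> p"
  proof -
    have "real (2 * card S + 1) < real p"
      using assms(6) by simp
    then show ?thesis
      unfolding of_nat_less_iff by simp
  qed
  ultimately have "2 \<le> card ?T"
    using card_excluded_slopes_le[OF \<open>prime p\<close> \<open>finite S\<close>] by linarith
  then obtain s t where st: "s \<in> ?T" "t \<in> ?T" "s \<noteq> t"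
    by (meson card_2_iff' obtain_subset_with_card_n subsetD)
  have "orthogonal ?G (slope_colour p s) (slope_colour p t)"
    using slope_colour_pair_inj[OF \<open>prime p\<close>] st by (auto simp: orthogonal_def verts)
  then have "orthogonal_colouring ?G {..<p} (slope_colour p s, slope_colour p t)"
    using slope_colour_proper[OF \<open>prime p\<close> \<open>0 \<notin> S\<close>] st by (simp add: orthogonal_colouring_def)
  moreover have "p \<le> k" if "orthogonal_colouring ?G {..<k} fg" for k fg
  proof -
    obtain f g where "fg = (f, g)" by (cases fg)
    then have "p\<^sup>2 \<le> k\<^sup>2"
      using that card_pverts_le_of_orthogonal_colouring[of ?G "{..<k}" f g]
      by (simp add: verts nat_power_eq)
    then show ?thesis by simp
  qed
  ultimately show ?thesis
    unfolding orthogonal_chromatic_number_def by (intro Least_equality) blast+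
qed

end
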